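(* For every integer $\gamma\ge0$, the vector space $\mathcal{F}_\gamma$ of $\gamma$-edge valued binary trees, endowed with the operations $\hookleftarrow_a,\hookrightarrow_a$ ($a\in[\gamma]$) defined below, is the free $\gamma$-multiplicial algebra over one generator, the generator being the tree with one internal node: $\mathcal{F}_\gamma$ is a $\gamma$-multiplicial algebra, and for every $\gamma$-multiplicial algebra $A$ and every $e\in A$ there is a unique linear map $\mathcal{F}_\gamma\to A$ commuting with all the operations and sending the one-node tree to $e$.
   Context: $\mathbb{K}$ is a field of characteristic zero, $[n]=\{1,\dots,n\}$, $a\downarrow a'=\min(a,a')$, with $a\downarrow\infty=a=\infty\downarrow a$. A $\gamma$-multiplicial algebra is a vector space with bilinear operations $\hookleftarrow_a,\hookrightarrow_a$, $a\in[\gamma]$, such that for all $x,y,z$ and $a,a'\in[\gamma]$: $(x\hookrightarrow_{a'}y)\hookleftarrow_a z=x\hookrightarrow_{a'}(y\hookleftarrow_a z)$; $(x\hookleftarrow_{a'}y)\hookleftarrow_a z=x\hookleftarrow_{a\downarrow a'}(y\hookleftarrow_a z)$; $(x\hookrightarrow_a y)\hookrightarrow_{a\downarrow a'}z=x\hookrightarrow_a(y\hookrightarrow_{a'}z)$. A $\gamma$-edge valued binary tree is a planar binary tree with at least one internal node in which every edge joining two internal nodes is labeled by an element of $[\gamma]$; edges from an internal node to a leaf are regarded as labeled $\infty$. $\mathcal{F}_\gamma$ has basis these trees. Write $\ell$ for the leaf and $N(x,t_1;y,t_2)$ for the tree whose root has left subtree $t_1$ via an edge labeled $x$ and right subtree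 $t_2$ via an edge labeled $y$. Operations (bilinear, recursive): for a tree $s$, $s\hookleftarrow_a\ell:=s$, $\ell\hookrightarrow_a s:=s$, $\ell\hookleftarrow_a s:=0$, $s\hookrightarrow_a\ell:=0$; for $t=N(x,t_1;y,t_2)$, $t\hookleftarrow_a s:=N(x,t_1;a\downarrow y,t_2\hookleftarrow_a s)$ and $s\hookrightarrow_a t:=N(a\downarrow x,s\hookrightarrow_a t_1;y,t_2)$.
   Formalization: The rules ℓ↩_a s := 0 and s↪_a ℓ := 0 are replaced by ℓ↩_a s := s and s↪_a ℓ := s (grafting s at the leaf); with the value 0 all products vanish and F_γ is not free for γ ≥ 1 (take A = K with multiplication, e = 1). *)

theory Defs
  imports Complex_Main "HOL-Library.Poly_Mapping" "HOL-Library.Extended_Nat" "HOL-Library.FuncSet"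
begin

(* A multiplicial algebra lives on a linear subspace V of an ambient vector space, so that
   spaces depending on the natural number gamma can be carriers; V may be UNIV. *)
locale multiplicial_algebra = vector_space scale
  for scale :: "'k::field_char_0 \<Rightarrow> 'b::ab_group_add \<Rightarrow> 'b" (infixr \<open>*s\<close> 75) +
  fixes \<gamma> :: nat
    and V :: "'b set"
    and L :: "nat \<Rightarrow> 'b \<Rightarrow> 'b \<Rightarrow> 'b"
    and R :: "nat \<Rightarrow> 'b \<Rightarrow> 'b \<Rightarrow> 'b"
  assumes subspace_carrier: "subspace V"
    and L_closed: "\<lbrakk>a \<in> {1..\<gamma>}; x \<in> V; y \<in> V\<rbrakk> \<Longrightarrow> L a x y \<in> V"
    and R_closed: "\<lbrakk>a \<in> {1..\<gamma>}; x \<in> V; y \<in> V\<rbrakk> \<Longrightarrow> R a x y \<in> V"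
    and L_add_left: "\<lbrakk>a \<in> {1..\<gamma>}; x \<in> V; y \<in> V; z \<in> V\<rbrakk> \<Longrightarrow> L a (x + y) z = L a x z + L a y z"
    and L_add_right: "\<lbrakk>a \<in> {1..\<gamma>}; x \<in> V; y \<in> V; z \<in> V\<rbrakk> \<Longrightarrow> L a x (y + z) = L a x y + L a x z"
    and L_scale_left: "\<lbrakk>a \<in> {1..\<gamma>}; x \<in> V; y \<in> V\<rbrakk> \<Longrightarrow> L a (c *s x) y = c *s L a x y"
    and L_scale_right: "\<lbrakk>a \<in> {1..\<gamma>}; x \<in> V; y \<in> V\<rbrakk> \<Longrightarrow> L a x (c *s y) = c *s L a x y"
    and R_add_left: "\<lbrakk>a \<in> {1..\<gamma>}; x \<in> V; y \<in> V; z \<in> V\<rbrakk> \<Longrightarrow> R a (x + y) z = R a x z + R a y z"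
    and R_add_right: "\<lbrakk>a \<in> {1..\<gamma>}; x \<in> V; y \<in> V; z \<in> V\<rbrakk> \<Longrightarrow> R a x (y + z) = R a x y + R a x z"
    and R_scale_left: "\<lbrakk>a \<in> {1..\<gamma>}; x \<in> V; y \<in> V\<rbrakk> \<Longrightarrow> R a (c *s x) y = c *s R a x y"
    and R_scale_right: "\<lbrakk>a \<in> {1..\<gamma>}; x \<in> V; y \<in> V\<rbrakk> \<Longrightarrow> R a x (c *s y) = c *s R a x y"
    and R_L: "\<lbrakk>a \<in> {1..\<gamma>}; a' \<in> {1..\<gamma>}; x \<in> V; y \<in> V; z \<in> V\<rbrakk>
      \<Longrightarrow> L a (R a' x y) z = R a' x (L a y z)"
    and L_L: "\<lbrakk>a \<in> {1..\<gamma>}; a' \<in> {1..\<gamma>}; x \<in> V; y \<in> V; z \<in> V\<rbrakk>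
      \<Longrightarrow> L a (L a' x y) z = L (min a a') x (L a y z)"
    and R_R: "\<lbrakk>a \<in> {1..\<gamma>}; a' \<in> {1..\<gamma>}; x \<in> V; y \<in> V; z \<in> V\<rbrakk>
      \<Longrightarrow> R (min a a') (R a x y) z = R a x (R a' y z)"

definition linear_map_on ::
  "('k::field_char_0 \<Rightarrow> 'b::ab_group_add \<Rightarrow> 'b) \<Rightarrow> ('k \<Rightarrow> 'c::ab_group_add \<Rightarrow> 'c)
    \<Rightarrow> 'b set \<Rightarrow> ('b \<Rightarrow> 'c) \<Rightarrow> bool"
  where "linear_map_on s\<^sub>1 s\<^sub>2 V f \<longleftrightarrow>
    (\<forall>x\<in>V. \<forall>y\<in>V. f (x + y) = f x + f y) \<and> (\<forall>c. \<forall>x\<in>V. f (s\<^sub>1 c x) = s\<^sub>2 c (f x))"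

definition commutes_on ::
  "nat \<Rightarrow> (nat \<Rightarrow> 'b \<Rightarrow> 'b \<Rightarrow> 'b) \<Rightarrow> (nat \<Rightarrow> 'c \<Rightarrow> 'c \<Rightarrow> 'c) \<Rightarrow> 'b set \<Rightarrow> ('b \<Rightarrow> 'c) \<Rightarrow> bool"
  where "commutes_on \<gamma> P Q V f \<longleftrightarrow>
    (\<forall>a\<in>{1..\<gamma>}. \<forall>x\<in>V. \<forall>y\<in>V. f (P a x y) = Q a (f x) (f y))"

(* Node x t1 y t2 stands for N(x,t1;y,t2). *)
datatype evtree = Leaf | Node enat evtree enat evtree

fun edge_ok :: "nat \<Rightarrow> enat \<Rightarrow> evtree \<Rightarrow> bool" where
  "edge_ok \<gamma> x Leaf \<longleftrightarrow> x = \<infinity>"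
| "edge_ok \<gamma> x (Node _ _ _ _) \<longleftrightarrow> x \<in> enat ` {1..\<gamma>}"

fun labels_ok :: "nat \<Rightarrow> evtree \<Rightarrow> bool" where
  "labels_ok \<gamma> Leaf \<longleftrightarrow> True"
| "labels_ok \<gamma> (Node x t\<^sub>1 y t\<^sub>2) \<longleftrightarrow>
    edge_ok \<gamma> x t\<^sub>1 \<and> edge_ok \<gamma> y t\<^sub>2 \<and> labels_ok \<gamma> t\<^sub>1 \<and> labels_ok \<gamma> t\<^sub>2"

definition evtrees :: "nat \<Rightarrow> evtree set" where
  "evtrees \<gamma> = {t. t \<noteq> Leaf \<and> labels_ok \<gamma> t}"

(* The leaf is neutral on both sides. With the value 0 for Leaf on the left of tree_L (or on the
   right of tree_R) every product would vanish, since the recursion always descends to a leaf,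
   and the resulting algebra would not be free. *)
fun tree_L :: "nat \<Rightarrow> evtree \<Rightarrow> evtree \<Rightarrow> evtree" where
  "tree_L a t Leaf = t"
| "tree_L a Leaf s = s"
| "tree_L a (Node x t\<^sub>1 y t\<^sub>2) s = Node x t\<^sub>1 (min (enat a) y) (tree_L a t\<^sub>2 s)"

fun tree_R :: "nat \<Rightarrow> evtree \<Rightarrow> evtree \<Rightarrow> evtree" where
  "tree_R a Leaf t = t"
| "tree_R a s Leaf = s"
| "tree_R a s (Node x t\<^sub>1 y t\<^sub>2) = Node (min (enat a) x) (tree_R a s t\<^sub>1) y t\<^sub>2"

definition F_space :: "nat \<Rightarrow> (evtree \<Rightarrow>\<^sub>0 'k::field_char_0) set" where
  "F_space \<gamma> = {v. Poly_Mapping.keys v \<subseteq> evtrees \<gamma>}"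

definition F_scale :: "'k::field_char_0 \<Rightarrow> (evtree \<Rightarrow>\<^sub>0 'k) \<Rightarrow> (evtree \<Rightarrow>\<^sub>0 'k)" where
  "F_scale c v = Poly_Mapping.map ((*) c) v"

definition bilinear_ext ::
  "(evtree \<Rightarrow> evtree \<Rightarrow> evtree) \<Rightarrow> (evtree \<Rightarrow>\<^sub>0 'k::field_char_0) \<Rightarrow> (evtree \<Rightarrow>\<^sub>0 'k) \<Rightarrow> (evtree \<Rightarrow>\<^sub>0 'k)"
  where "bilinear_ext p u v =
    (\<Sum>s\<in>Poly_Mapping.keys u. \<Sum>t\<in>Poly_Mapping.keys v.
      Poly_Mapping.single (p s t) (Poly_Mapping.lookup u s * Poly_Mapping.lookup v t))"

definition F_L :: "nat \<Rightarrow> (evtree \<Rightarrow>\<^sub>0 'k::field_char_0) \<Rightarrow> (evtree \<Rightarrow>\<^sub>0 'k) \<Rightarrow> (evtree \<Rightarrow>\<^sub>0 'k)" where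
  "F_L a = bilinear_ext (tree_L a)"

definition F_R :: "nat \<Rightarrow> (evtree \<Rightarrow>\<^sub>0 'k::field_char_0) \<Rightarrow> (evtree \<Rightarrow>\<^sub>0 'k) \<Rightarrow> (evtree \<Rightarrow>\<^sub>0 'k)" where
  "F_R a = bilinear_ext (tree_R a)"

definition F_gen :: "evtree \<Rightarrow>\<^sub>0 'k::field_char_0" where
  "F_gen = Poly_Mapping.single (Node \<infinity> Leaf \<infinity> Leaf) 1"

end

(* The tree N(x,t1;y,t2) is the product t1 R_x (o L_y t2) of its subtrees with the one-node tree o
   (a factor is dropped when the subtree is a leaf), so a morphism is determined by the image e of
   o. Conversely, this formula defines the image of every tree in A, and it is compatible with the
   operations because the three axioms say exactly how L_a and R_a pass through it:
   (t1 R_x (e L_y t2)) L_a s = t1 R_x (e L_(min a y) (t2 L_a s)) and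
   s R_a (t1 R_x r) = (s R_a t1) R_(min a x) r. *)
theory Submission
  imports Defs
begin

section \<open>Linear extension\<close>

text \<open>The linear map out of the free vector space with value \<open>\<phi> t\<close> on each
  basis element \<open>t\<close>. The scalar action is an argument, so the target can be the tree
  space or any other vector space.\<close>

definition lin_ext :: "('k::field \<Rightarrow> 'b::ab_group_add \<Rightarrow> 'b) \<Rightarrow> ('a \<Rightarrow> 'b) \<Rightarrow> ('a \<Rightarrow>\<^sub>0 'k) \<Rightarrow> 'b"
  where "lin_ext s \<phi> v = (\<Sum>t\<in>Poly_Mapping.keys v. s (Poly_Mapping.lookup v t) (\<phi> t))"

context vector_space
begin

text \<open>Cancellation can shrink the keys of a sum or a multiple, so sums over different key sets
  are compared on one common finite set; the extra terms have coefficient 0.\<close>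

lemma lin_ext_superset:
  assumes "finite S" "Poly_Mapping.keys v \<subseteq> S"
  shows "lin_ext scale \<phi> v = (\<Sum>t\<in>S. scale (Poly_Mapping.lookup v t) (\<phi> t))"
  unfolding lin_ext_def using assms
  by (intro sum.mono_neutral_left) (auto simp: in_keys_iff)

lemma lin_ext_add: "lin_ext scale \<phi> (u + v) = lin_ext scale \<phi> u + lin_ext scale \<phi> v"
proof -
  let ?S = "Poly_Mapping.keys u \<union> Poly_Mapping.keys v"
  have "Poly_Mapping.keys (u + v) \<subseteq> ?S"
    by (rule Poly_Mapping.keys_add)
  then show ?thesis
    by (simp add: lin_ext_superset[where S = ?S] lookup_add scale_left_distrib sum.distrib)
qed

lemma lin_ext_single: "lin_ext scale \<phi> (Poly_Mapping.single t c) = scale c (\<phi> t)"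
  by (simp add: lin_ext_superset[where S = "{t}"])

lemma lin_ext_in_subspace:
  assumes "subspace V" "\<And>t. t \<in> Poly_Mapping.keys v \<Longrightarrow> \<phi> t \<in> V"
  shows "lin_ext scale \<phi> v \<in> V"
  unfolding lin_ext_def using assms by (intro subspace_sum subspace_scale) auto

end

section \<open>The vector space of tree combinations and bilinear extension\<close>

lemma lookup_F_scale: "Poly_Mapping.lookup (F_scale c v) t = c * Poly_Mapping.lookup v t"
  by (simp add: F_scale_def map.rep_eq when_def)

lemma F_scale_single: "F_scale c (Poly_Mapping.single t d) = Poly_Mapping.single t (c * d)"
  by (rule poly_mapping_eqI) (simp add: lookup_F_scale lookup_single when_def)

interpretation F: vector_space F_scale
  by unfold_locales (rule poly_mapping_eqI, simp add: lookup_F_scale lookup_add algebra_simps)+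

lemma lin_ext_scale:
  assumes "vector_space scale"
  shows "lin_ext scale \<phi> (F_scale c v) = scale c (lin_ext scale \<phi> v)"
proof -
  interpret vector_space scale by (rule assms)
  have "Poly_Mapping.keys (F_scale c v) \<subseteq> Poly_Mapping.keys v"
    by (auto simp: in_keys_iff lookup_F_scale)
  then show ?thesis
    by (simp add: lin_ext_superset[where S = "Poly_Mapping.keys v"] lookup_F_scale scale_sum_right)
qed

text \<open>With \<open>u\<close> in the outer sum the double sum is a linear extension in
  \<open>u\<close>, which gives linearity on the left. The next lemma swaps the sums to do the same
  for \<open>v\<close>.\<close>

lemma bilinear_ext_eq_left:
  "bilinear_ext p u v =
    lin_ext F_scale (\<lambda>s. lin_ext F_scale (\<lambda>t. Poly_Mapping.single (p s t) 1) v) u"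
  by (simp add: bilinear_ext_def lin_ext_def F.scale_sum_right F_scale_single)

lemma bilinear_ext_eq_right:
  "bilinear_ext p u v =
    lin_ext F_scale (\<lambda>t. lin_ext F_scale (\<lambda>s. Poly_Mapping.single (p s t) 1) u) v"
  unfolding bilinear_ext_def
  by (subst sum.swap) (simp add: lin_ext_def F.scale_sum_right F_scale_single mult.commute)

lemma bilinear_ext_add_left: "bilinear_ext p (u + v) w = bilinear_ext p u w + bilinear_ext p v w"
  by (simp add: bilinear_ext_eq_left F.lin_ext_add)

lemma bilinear_ext_add_right: "bilinear_ext p u (v + w) = bilinear_ext p u v + bilinear_ext p u w"
  by (simp add: bilinear_ext_eq_right F.lin_ext_add)

lemma bilinear_ext_scale_left: "bilinear_ext p (F_scale c u) v = F_scale c (bilinear_ext p u v)"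
  by (simp add: bilinear_ext_eq_left lin_ext_scale[OF F.vector_space_axioms])

lemma bilinear_ext_scale_right: "bilinear_ext p u (F_scale c v) = F_scale c (bilinear_ext p u v)"
  by (simp add: bilinear_ext_eq_right lin_ext_scale[OF F.vector_space_axioms])

lemma bilinear_ext_single:
  "bilinear_ext p (Poly_Mapping.single s c) (Poly_Mapping.single t d) =
    Poly_Mapping.single (p s t) (c * d)"
  by (simp add: bilinear_ext_eq_left F.lin_ext_single F_scale_single)

lemmas bilinear_ext_simps = bilinear_ext_add_left bilinear_ext_add_right bilinear_ext_single

section \<open>The algebra of trees\<close>

lemma subspace_F_space: "F.subspace (F_space \<gamma>)"
  unfolding F.subspace_def F_space_def
  by (auto simp: in_keys_iff lookup_F_scale lookup_add) (metis add_0 in_keys_iff subsetD)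

lemma one_node_in_evtrees: "Node \<infinity> Leaf \<infinity> Leaf \<in> evtrees \<gamma>"
  by (simp add: evtrees_def)

lemma single_in_F_space: "t \<in> evtrees \<gamma> \<Longrightarrow> Poly_Mapping.single t c \<in> F_space \<gamma>"
  by (simp add: F_space_def)

lemma F_space_induct [consumes 1, case_names single add]:
  assumes "v \<in> F_space \<gamma>"
    and single: "\<And>t c. t \<in> evtrees \<gamma> \<Longrightarrow> P (Poly_Mapping.single t c)"
    and add: "\<And>u v. \<lbrakk>u \<in> F_space \<gamma>; v \<in> F_space \<gamma>; P u; P v\<rbrakk> \<Longrightarrow> P (u + v)"
  shows "P v"
proof -
  let ?g = "\<lambda>t. Poly_Mapping.single t (Poly_Mapping.lookup v t)"
  \<comment> \<open>The one-node tree is valid for every \<gamma>, even 0, so the zero vector is the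
    case \<open>single\<close> with coefficient 0.\<close>
  have zero: "P 0"
    using single[OF one_node_in_evtrees, of 0] by simp
  \<comment> \<open>Membership is carried along with \<open>P\<close> because \<open>add\<close>
    asks for it at every partial sum.\<close>
  have sums: "sum ?g S \<in> F_space \<gamma> \<and> P (sum ?g S)" if "finite S" "S \<subseteq> evtrees \<gamma>" for S
    using that
    by (induction S rule: finite_induct)
      (auto simp: zero F.subspace_0[OF subspace_F_space]
        intro!: add single single_in_F_space F.subspace_add[OF subspace_F_space])
  have sum_v: "(\<Sum>t\<in>Poly_Mapping.keys v. ?g t) = v"
  proof (rule poly_mapping_eqI)
    fix k
    have "Poly_Mapping.lookup (\<Sum>t\<in>Poly_Mapping.keys v. ?g t) k =
        (\<Sum>t\<in>Poly_Mapping.keys v. if t = k then Poly_Mapping.lookup v t else 0)"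
      by (simp only: lookup_sum lookup_single when_def)
    also have "\<dots> = Poly_Mapping.lookup v k"
      by (subst sum.delta) (auto simp: in_keys_iff)
    finally show "Poly_Mapping.lookup (\<Sum>t\<in>Poly_Mapping.keys v. ?g t) k = Poly_Mapping.lookup v k" .
  qed
  have "Poly_Mapping.keys v \<subseteq> evtrees \<gamma>"
    using assms(1) by (simp add: F_space_def)
  from sums[OF finite_keys this] show ?thesis
    unfolding sum_v by (rule conjunct2)
qed

lemma bilinear_ext_in_F_space:
  assumes "\<And>s t. \<lbrakk>s \<in> evtrees \<gamma>; t \<in> evtrees \<gamma>\<rbrakk> \<Longrightarrow> p s t \<in> evtrees \<gamma>"
    and "u \<in> F_space \<gamma>" "v \<in> F_space \<gamma>"
  shows "bilinear_ext p u v \<in> F_space \<gamma>"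
  unfolding bilinear_ext_eq_left using assms
  by (intro F.lin_ext_in_subspace[OF subspace_F_space] single_in_F_space)
    (auto simp: F_space_def)

section \<open>Closure of the tree products\<close>

lemma tree_L_eq_Leaf_iff: "tree_L a t s = Leaf \<longleftrightarrow> t = Leaf \<and> s = Leaf"
  by (cases "(a, t, s)" rule: tree_L.cases) auto

lemma tree_R_eq_Leaf_iff: "tree_R a s t = Leaf \<longleftrightarrow> s = Leaf \<and> t = Leaf"
  by (cases "(a, s, t)" rule: tree_R.cases) auto

lemma edge_ok_iff: "edge_ok \<gamma> x t \<longleftrightarrow> (if t = Leaf then x = \<infinity> else x \<in> enat ` {1..\<gamma>})"
  by (cases t) auto

text \<open>If \<open>t\<close> is a leaf, then \<open>x\<close> is \<infinity> and the edge to
  \<open>s\<close> gets the label \<open>a\<close>; otherwise the new label is a minimum of two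
  elements of [\<gamma>].\<close>

lemma edge_ok_tree_L:
  assumes "a \<in> {1..\<gamma>}" "edge_ok \<gamma> x t" "s \<noteq> Leaf"
  shows "edge_ok \<gamma> (min (enat a) x) (tree_L a t s)"
  using assms by (auto simp: edge_ok_iff tree_L_eq_Leaf_iff min_def split: if_splits)

lemma edge_ok_tree_R:
  assumes "a \<in> {1..\<gamma>}" "edge_ok \<gamma> x t" "s \<noteq> Leaf"
  shows "edge_ok \<gamma> (min (enat a) x) (tree_R a s t)"
  using assms by (auto simp: edge_ok_iff tree_R_eq_Leaf_iff min_def split: if_splits)

lemma labels_ok_tree_L:
  assumes "a \<in> {1..\<gamma>}" "labels_ok \<gamma> t" "labels_ok \<gamma> s"
  shows "labels_ok \<gamma> (tree_L a t s)"
  using assms by (induction a t s rule: tree_L.induct) (auto intro!: edge_ok_tree_L)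

lemma labels_ok_tree_R:
  assumes "a \<in> {1..\<gamma>}" "labels_ok \<gamma> t" "labels_ok \<gamma> s"
  shows "labels_ok \<gamma> (tree_R a s t)"
  using assms by (induction a s t rule: tree_R.induct) (auto intro!: edge_ok_tree_R)

lemma tree_L_in_evtrees:
  "\<lbrakk>a \<in> {1..\<gamma>}; t \<in> evtrees \<gamma>; s \<in> evtrees \<gamma>\<rbrakk> \<Longrightarrow> tree_L a t s \<in> evtrees \<gamma>"
  by (simp add: evtrees_def tree_L_eq_Leaf_iff labels_ok_tree_L)

lemma tree_R_in_evtrees:
  "\<lbrakk>a \<in> {1..\<gamma>}; s \<in> evtrees \<gamma>; t \<in> evtrees \<gamma>\<rbrakk> \<Longrightarrow> tree_R a s t \<in> evtrees \<gamma>"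
  by (simp add: evtrees_def tree_R_eq_Leaf_iff labels_ok_tree_R)

section \<open>The multiplicial identities on trees\<close>

lemma tree_L_Leaf_left [simp]: "tree_L a Leaf s = s"
  by (cases s) auto

lemma tree_R_Leaf_right [simp]: "tree_R a s Leaf = s"
  by (cases s) auto

lemma tree_L_Node:
  "s \<noteq> Leaf \<Longrightarrow> tree_L a (Node x t\<^sub>1 y t\<^sub>2) s = Node x t\<^sub>1 (min (enat a) y) (tree_L a t\<^sub>2 s)"
  by (cases s) auto

lemma tree_R_Node:
  "s \<noteq> Leaf \<Longrightarrow> tree_R a s (Node x t\<^sub>1 y t\<^sub>2) = Node (min (enat a) x) (tree_R a s t\<^sub>1) y t\<^sub>2"
  by (cases s) auto

text \<open>At the root of \<open>t\<close>, \<open>tree_R\<close> changes only the left edge and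
  subtree and \<open>tree_L\<close> only the right ones, so the two operations commute.\<close>

lemma tree_R_L:
  assumes "t \<noteq> Leaf"
  shows "tree_L a (tree_R a' s t) u = tree_R a' s (tree_L a t u)"
  using assms by (cases t; cases "s = Leaf"; cases "u = Leaf") (auto simp: tree_L_Node tree_R_Node)

text \<open>Along the right spine of \<open>s\<close> both sides replace each label by its minimum
  with \<open>a\<close> and \<open>a'\<close>; at the end of the spine both become
  \<open>tree_L a t u\<close>. A leaf for \<open>t\<close> or \<open>u\<close> would leave minima
  with different indices on the two sides.\<close>

lemma tree_L_L:
  assumes "t \<noteq> Leaf" "u \<noteq> Leaf"
  shows "tree_L a (tree_L a' s t) u = tree_L (min a a') s (tree_L a t u)"
  using assms
  \<comment> \<open>The minimum of naturals is turned into one of extended naturals, against the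
    default simp direction, so that associativity of \<open>min\<close> applies.\<close>
  by (induction s) (auto simp: tree_L_Node tree_L_eq_Leaf_iff min.assoc
    min_enat_simps(1)[symmetric] simp del: min_enat_simps)

text \<open>Mirror image of \<open>tree_L_L\<close>: the induction descends the left spine of
  \<open>u\<close>.\<close>

lemma tree_R_R:
  assumes "s \<noteq> Leaf" "t \<noteq> Leaf"
  shows "tree_R (min a a') (tree_R a s t) u = tree_R a s (tree_R a' t u)"
  using assms
  by (induction u) (auto simp: tree_R_Node tree_R_eq_Leaf_iff min.assoc
    min_enat_simps(1)[symmetric] simp del: min_enat_simps)

text \<open>Both sides are trilinear, so equality on triples of trees suffices. The four products
  are left free so that one lemma serves all three axioms.\<close>

lemma F_space_trilinear_eq:
  fixes u v w :: "evtree \<Rightarrow>\<^sub>0 'k::field_char_0"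
  assumes "u \<in> F_space \<gamma>" "v \<in> F_space \<gamma>" "w \<in> F_space \<gamma>"
    and tree: "\<And>r s t. \<lbrakk>r \<in> evtrees \<gamma>; s \<in> evtrees \<gamma>; t \<in> evtrees \<gamma>\<rbrakk>
      \<Longrightarrow> p (q r s) t = p' r (q' s t)"
  shows "bilinear_ext p (bilinear_ext q u v) w = bilinear_ext p' u (bilinear_ext q' v w)"
  using assms(1)
proof (induction rule: F_space_induct)
  case (single r c)
  show ?case
    using assms(2)
  proof (induction rule: F_space_induct)
    case (single s d)
    show ?case
      using assms(3)
    proof (induction rule: F_space_induct)
      case (single t d)
      then show ?case
        using tree \<open>r \<in> evtrees \<gamma>\<close> \<open>s \<in> evtrees \<gamma>\<close>
        by (simp add: bilinear_ext_single mult.assoc)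
    qed (simp add: bilinear_ext_simps)
  qed (simp add: bilinear_ext_simps)
qed (simp add: bilinear_ext_simps)

lemma multiplicial_algebra_F: "multiplicial_algebra F_scale \<gamma> (F_space \<gamma>) F_L F_R"
proof unfold_locales
  show "F.subspace (F_space \<gamma>)"
    by (rule subspace_F_space)
next
  fix a a' and x y z :: "evtree \<Rightarrow>\<^sub>0 'a"
  assume V: "x \<in> F_space \<gamma>" "y \<in> F_space \<gamma>" "z \<in> F_space \<gamma>"
  show "F_L a (F_R a' x y) z = F_R a' x (F_L a y z)"
    unfolding F_L_def F_R_def
    by (rule F_space_trilinear_eq[OF V]) (simp add: evtrees_def tree_R_L)
  show "F_L a (F_L a' x y) z = F_L (min a a') x (F_L a y z)"
    unfolding F_L_def
    by (rule F_space_trilinear_eq[OF V]) (simp add: evtrees_def tree_L_L)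
  show "F_R (min a a') (F_R a x y) z = F_R a x (F_R a' y z)"
    unfolding F_R_def
    by (rule F_space_trilinear_eq[OF V]) (simp add: evtrees_def tree_R_R)
qed (auto simp: F_L_def F_R_def
    bilinear_ext_add_left bilinear_ext_add_right bilinear_ext_scale_left bilinear_ext_scale_right
    intro!: bilinear_ext_in_F_space tree_L_in_evtrees tree_R_in_evtrees)

section \<open>Evaluation of trees\<close>

(* The value at Leaf is junk. *)
fun tree_eval :: "(nat \<Rightarrow> 'b \<Rightarrow> 'b \<Rightarrow> 'b) \<Rightarrow> (nat \<Rightarrow> 'b \<Rightarrow> 'b \<Rightarrow> 'b) \<Rightarrow> 'b \<Rightarrow> evtree \<Rightarrow> 'b" where
  "tree_eval L R e Leaf = e"
| "tree_eval L R e (Node x t\<^sub>1 y t\<^sub>2) =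
    (let r = (if t\<^sub>2 = Leaf then e else L (the_enat y) e (tree_eval L R e t\<^sub>2))
     in if t\<^sub>1 = Leaf then r else R (the_enat x) (tree_eval L R e t\<^sub>1) r)"

section \<open>Compatibility of evaluation with the products\<close>

context multiplicial_algebra
begin

text \<open>\<open>the_enat\<close> is applied only to edges between internal nodes, whose labels
  lie in [\<gamma>], so \<open>L\<close> and \<open>R\<close> stay in \<open>V\<close>.\<close>

lemma tree_eval_in_carrier:
  assumes "e \<in> V" "labels_ok \<gamma> t"
  shows "tree_eval L R e t \<in> V"
  using assms by (induction t) (auto simp: Let_def edge_ok_iff split: if_splits intro!: L_closed R_closed)

text \<open>Induction along the right spine of \<open>t\<close>: \<open>R_L\<close> carries the
  operation past the left factor, and \<open>L_L\<close> pushes it onto the right subtree.\<close>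

lemma tree_eval_tree_L:
  assumes "e \<in> V" "a \<in> {1..\<gamma>}" "labels_ok \<gamma> t" "t \<noteq> Leaf" "labels_ok \<gamma> s" "s \<noteq> Leaf"
  shows "tree_eval L R e (tree_L a t s) = L a (tree_eval L R e t) (tree_eval L R e s)"
  using assms(3,4)
proof (induction t)
  case Leaf
  then show ?case by simp
next
  case (Node x t\<^sub>1 y t\<^sub>2)
  let ?E = "tree_eval L R e"
  let ?r = "if t\<^sub>2 = Leaf then e else L (the_enat y) e (?E t\<^sub>2)"
  have t1: "?E t\<^sub>1 \<in> V" and t2: "?E t\<^sub>2 \<in> V" and s: "?E s \<in> V"
    using Node.prems assms by (auto intro!: tree_eval_in_carrier)
  have y: "y = enat (the_enat y) \<and> the_enat y \<in> {1..\<gamma>}" if "t\<^sub>2 \<noteq> Leaf"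
    using Node.prems that by (auto simp: edge_ok_iff)
  have x: "the_enat x \<in> {1..\<gamma>}" if "t\<^sub>1 \<noteq> Leaf"
    using Node.prems that by (auto simp: edge_ok_iff)
  have r: "?r \<in> V"
    using y t2 assms(1) by (auto intro!: L_closed)
  \<comment> \<open>This settles the factor formed by \<open>e\<close> and the right subtree. If
    that subtree is a leaf, \<open>y\<close> is \<infinity> and the minimum is \<open>a\<close>;
    otherwise \<open>y\<close> is finite and the minimum is the index in \<open>L_L\<close>.\<close>
  have key: "L (the_enat (min (enat a) y)) e (?E (tree_L a t\<^sub>2 s)) = L a ?r (?E s)"
  proof (cases "t\<^sub>2 = Leaf")
    case True
    then show ?thesis using Node.prems by simp
  next
    case False
    then have "min (enat a) y = enat (min a (the_enat y))"
      using y by (metis min_enat_simps(1))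
    then show ?thesis
      using False Node y t2 s assms by (simp add: L_L)
  qed
  show ?case
    using key x r t1 s assms by (auto simp: Let_def tree_L_Node tree_L_eq_Leaf_iff R_L)
qed

text \<open>The product with the left subtree is outermost in the evaluation, so \<open>R_R\<close>
  alone moves \<open>s\<close> onto that subtree, and the factor formed by \<open>e\<close> and the
  right subtree stays fixed.\<close>

lemma tree_eval_tree_R:
  assumes "e \<in> V" "a \<in> {1..\<gamma>}" "labels_ok \<gamma> t" "t \<noteq> Leaf" "labels_ok \<gamma> s" "s \<noteq> Leaf"
  shows "tree_eval L R e (tree_R a s t) = R a (tree_eval L R e s) (tree_eval L R e t)"
  using assms(3,4)
proof (induction t)
  case Leaf
  then show ?case by simp
next
  case (Node x t\<^sub>1 y t\<^sub>2)
  let ?E = "tree_eval L R e"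
  let ?r = "if t\<^sub>2 = Leaf then e else L (the_enat y) e (?E t\<^sub>2)"
  have t1: "?E t\<^sub>1 \<in> V" and t2: "?E t\<^sub>2 \<in> V" and s: "?E s \<in> V"
    using Node.prems assms by (auto intro!: tree_eval_in_carrier)
  have y: "the_enat y \<in> {1..\<gamma>}" if "t\<^sub>2 \<noteq> Leaf"
    using Node.prems that by (auto simp: edge_ok_iff)
  have r: "?r \<in> V"
    using y t2 assms(1) by (auto intro!: L_closed)
  show ?case
  proof (cases "t\<^sub>1 = Leaf")
    case True
    then show ?thesis using Node.prems assms by (simp add: tree_R_Node Let_def)
  next
    case False
    then have x: "x = enat (the_enat x)" "the_enat x \<in> {1..\<gamma>}"
      using Node.prems by (auto simp: edge_ok_iff)
    then have "min (enat a) x = enat (min a (the_enat x))"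
      by (metis min_enat_simps(1))
    moreover have "?E (tree_R a s t\<^sub>1) = R a (?E s) (?E t\<^sub>1)"
      using Node False by simp
    moreover have "R (min a (the_enat x)) (R a (?E s) (?E t\<^sub>1)) ?r = R a (?E s) (R (the_enat x) (?E t\<^sub>1) ?r)"
      using R_R x s t1 r assms(2) by blast
    ultimately show ?thesis
      using False assms by (simp add: tree_R_Node tree_R_eq_Leaf_iff Let_def)
  qed
qed

section \<open>Existence of the morphism\<close>

lemma lin_ext_bilinear_ext:
  fixes u v :: "evtree \<Rightarrow>\<^sub>0 'k"
  assumes "u \<in> F_space \<gamma>" "v \<in> F_space \<gamma>"
    and carrier: "\<And>t. t \<in> evtrees \<gamma> \<Longrightarrow> \<phi> t \<in> V"
    and hom: "\<And>s t. \<lbrakk>s \<in> evtrees \<gamma>; t \<in> evtrees \<gamma>\<rbrakk> \<Longrightarrow> \<phi> (p s t) = P (\<phi> s) (\<phi> t)"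
    and add: "\<And>x y z. \<lbrakk>x \<in> V; y \<in> V; z \<in> V\<rbrakk> \<Longrightarrow> P (x + y) z = P x z + P y z"
      "\<And>x y z. \<lbrakk>x \<in> V; y \<in> V; z \<in> V\<rbrakk> \<Longrightarrow> P x (y + z) = P x y + P x z"
    and scale: "\<And>c x y. \<lbrakk>x \<in> V; y \<in> V\<rbrakk> \<Longrightarrow> P (c *s x) y = c *s P x y"
      "\<And>c x y. \<lbrakk>x \<in> V; y \<in> V\<rbrakk> \<Longrightarrow> P x (c *s y) = c *s P x y"
  shows "lin_ext scale \<phi> (bilinear_ext p u v) = P (lin_ext scale \<phi> u) (lin_ext scale \<phi> v)"
proof -
  \<comment> \<open>\<open>P\<close> is bilinear only on \<open>V\<close>, so images of vectors must
    be placed in \<open>V\<close> before the induction on \<open>u\<close> and \<open>v\<close>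
    reduces the claim to trees.\<close>
  have V: "lin_ext scale \<phi> w \<in> V" if "w \<in> F_space \<gamma>" for w :: "evtree \<Rightarrow>\<^sub>0 'k"
    using that carrier by (intro lin_ext_in_subspace[OF subspace_carrier]) (auto simp: F_space_def)
  show ?thesis
    using assms(1)
  proof (induction rule: F_space_induct)
    case (single s c)
    show ?case
      using assms(2)
    proof (induction rule: F_space_induct)
      case (single t d)
      have "c *s \<phi> s \<in> V" "d *s \<phi> t \<in> V"
        using single \<open>s \<in> evtrees \<gamma>\<close> by (auto intro!: carrier subspace_scale[OF subspace_carrier])
      then show ?case
        using single \<open>s \<in> evtrees \<gamma>\<close>
        by (simp add: bilinear_ext_single lin_ext_single hom scale carrier)
    next
      case (add v w)
      then show ?case
        using single by (simp add: bilinear_ext_add_right lin_ext_add assms(6) V single_in_F_space)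
    qed
  next
    case (add u w)
    then show ?case
      using assms(2) by (simp add: bilinear_ext_add_left lin_ext_add assms(5) V)
  qed
qed

text \<open>The linear extension of the evaluation is restricted to \<open>F_space \<gamma>\<close>,
  with value \<open>undefined\<close> elsewhere, so that uniqueness can be literal equality of
  functions.\<close>

lemma morphism_exists:
  assumes e: "e \<in> V"
  defines "f \<equiv> restrict (lin_ext scale (tree_eval L R e)) (F_space \<gamma>)"
  shows "f \<in> F_space \<gamma> \<rightarrow>\<^sub>E V" "linear_map_on F_scale scale (F_space \<gamma>) f"
    "commutes_on \<gamma> F_L L (F_space \<gamma>) f" "commutes_on \<gamma> F_R R (F_space \<gamma>) f" "f F_gen = e"
proof -
  \<comment> \<open>Supplies closure of the products: the restriction \<open>f\<close> agrees with
    the linear extension at a product once that product lies in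
    \<open>F_space \<gamma>\<close>.\<close>
  interpret FA: multiplicial_algebra "F_scale :: 'k \<Rightarrow> _" \<gamma> "F_space \<gamma>" F_L F_R
    by (rule multiplicial_algebra_F)
  have eval: "tree_eval L R e t \<in> V" if "t \<in> evtrees \<gamma>" for t
    using that e by (auto simp: evtrees_def intro: tree_eval_in_carrier)
  show "f \<in> F_space \<gamma> \<rightarrow>\<^sub>E V"
    unfolding f_def using eval
    by (auto simp: F_space_def intro!: lin_ext_in_subspace[OF subspace_carrier])
  show "linear_map_on F_scale scale (F_space \<gamma>) f"
    unfolding f_def linear_map_on_def
    by (auto simp: lin_ext_add lin_ext_scale[OF vector_space_axioms] F.subspace_add[OF subspace_F_space]
        F.subspace_scale[OF subspace_F_space])
  show "commutes_on \<gamma> F_L L (F_space \<gamma>) f"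
    unfolding commutes_on_def
  proof (intro ballI)
    fix a and u v :: "evtree \<Rightarrow>\<^sub>0 'k"
    assume a: "a \<in> {1..\<gamma>}" and u: "u \<in> F_space \<gamma>" and v: "v \<in> F_space \<gamma>"
    have "lin_ext scale (tree_eval L R e) (F_L a u v) =
        L a (lin_ext scale (tree_eval L R e) u) (lin_ext scale (tree_eval L R e) v)"
      unfolding F_L_def using u v eval
      by (rule lin_ext_bilinear_ext)
        (use a e in \<open>auto simp: evtrees_def L_add_left L_add_right L_scale_left L_scale_right
          intro!: tree_eval_tree_L\<close>)
    then show "f (F_L a u v) = L a (f u) (f v)"
      using a u v FA.L_closed by (simp add: f_def)
  qed
  show "commutes_on \<gamma> F_R R (F_space \<gamma>) f"
    unfolding commutes_on_def
  proof (intro ballI)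
    fix a and u v :: "evtree \<Rightarrow>\<^sub>0 'k"
    assume a: "a \<in> {1..\<gamma>}" and u: "u \<in> F_space \<gamma>" and v: "v \<in> F_space \<gamma>"
    have "lin_ext scale (tree_eval L R e) (F_R a u v) =
        R a (lin_ext scale (tree_eval L R e) u) (lin_ext scale (tree_eval L R e) v)"
      unfolding F_R_def using u v eval
      by (rule lin_ext_bilinear_ext)
        (use a e in \<open>auto simp: evtrees_def R_add_left R_add_right R_scale_left R_scale_right
          intro!: tree_eval_tree_R\<close>)
    then show "f (F_R a u v) = R a (f u) (f v)"
      using a u v FA.R_closed by (simp add: f_def)
  qed
  show "f F_gen = e"
    by (simp add: f_def F_gen_def lin_ext_single single_in_F_space one_node_in_evtrees)
qed

section \<open>Uniqueness of the morphism\<close>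

lemma morphism_single:
  fixes f :: "(evtree \<Rightarrow>\<^sub>0 'k) \<Rightarrow> 'b"
  assumes "commutes_on \<gamma> F_L L (F_space \<gamma>) f" "commutes_on \<gamma> F_R R (F_space \<gamma>) f"
    and "t \<in> evtrees \<gamma>"
  shows "f (Poly_Mapping.single t 1) = tree_eval L R (f F_gen) t"
  using assms(3)
proof (induction t)
  case Leaf
  then show ?case by (simp add: evtrees_def)
next
  case (Node x t\<^sub>1 y t\<^sub>2)
  let ?o = "Node \<infinity> Leaf \<infinity> Leaf"
  let ?E = "tree_eval L R (f F_gen)"
  \<comment> \<open>The tree with its left subtree removed. The edge to the new leaf is labeled
    \<infinity>, so grafting the subtree back with index \<open>a\<close> gives the label
    \<open>a\<close>.\<close>
  let ?r = "Node \<infinity> Leaf y t\<^sub>2"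
  \<comment> \<open>Products of trees with coefficient 1 are again trees with coefficient 1, so
    commutation becomes a statement about trees.\<close>
  have L: "f (Poly_Mapping.single (tree_L a s t) 1) =
      L a (f (Poly_Mapping.single s 1)) (f (Poly_Mapping.single t 1))"
    and R: "f (Poly_Mapping.single (tree_R a s t) 1) =
      R a (f (Poly_Mapping.single s 1)) (f (Poly_Mapping.single t 1))"
    if "a \<in> {1..\<gamma>}" "s \<in> evtrees \<gamma>" "t \<in> evtrees \<gamma>" for a s t
  proof -
    have "f (F_L a (Poly_Mapping.single s 1) (Poly_Mapping.single t 1)) =
        L a (f (Poly_Mapping.single s 1)) (f (Poly_Mapping.single t 1))"
      "f (F_R a (Poly_Mapping.single s 1) (Poly_Mapping.single t 1)) =
        R a (f (Poly_Mapping.single s 1)) (f (Poly_Mapping.single t 1))"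
      using assms(1,2) that single_in_F_space unfolding commutes_on_def by blast+
    then show "f (Poly_Mapping.single (tree_L a s t) 1) =
        L a (f (Poly_Mapping.single s 1)) (f (Poly_Mapping.single t 1))"
      "f (Poly_Mapping.single (tree_R a s t) 1) =
        R a (f (Poly_Mapping.single s 1)) (f (Poly_Mapping.single t 1))"
      by (simp_all add: F_L_def F_R_def bilinear_ext_single)
  qed
  have ok: "edge_ok \<gamma> x t\<^sub>1" "edge_ok \<gamma> y t\<^sub>2" "labels_ok \<gamma> t\<^sub>1" "labels_ok \<gamma> t\<^sub>2"
    using Node.prems by (auto simp: evtrees_def)
  have r: "f (Poly_Mapping.single ?r 1) = ?E ?r"
  proof (cases "t\<^sub>2 = Leaf")
    case True
    then show ?thesis using ok by (simp add: F_gen_def)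
  next
    case False
    then obtain a where a: "y = enat a" "a \<in> {1..\<gamma>}"
      using ok by (auto simp: edge_ok_iff)
    have t2: "t\<^sub>2 \<in> evtrees \<gamma>"
      using False ok by (simp add: evtrees_def)
    have "?r = tree_L a ?o t\<^sub>2"
      using False a by (simp add: tree_L_Node)
    then have "f (Poly_Mapping.single ?r 1) = L a (f F_gen) (f (Poly_Mapping.single t\<^sub>2 1))"
      using L[OF a(2) one_node_in_evtrees t2] by (simp add: F_gen_def)
    then show ?thesis
      using False a Node.IH(2)[OF t2] by simp
  qed
  show ?case
  proof (cases "t\<^sub>1 = Leaf")
    case True
    then show ?thesis using ok r by simp
  next
    case False
    then obtain a where a: "x = enat a" "a \<in> {1..\<gamma>}"
      using ok by (auto simp: edge_ok_iff)
    have t1: "t\<^sub>1 \<in> evtrees \<gamma>" and r': "?r \<in> evtrees \<gamma>"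
      using False ok by (simp_all add: evtrees_def)
    have "Node x t\<^sub>1 y t\<^sub>2 = tree_R a t\<^sub>1 ?r"
      using False a by (simp add: tree_R_Node)
    then have "f (Poly_Mapping.single (Node x t\<^sub>1 y t\<^sub>2) 1) = R a (?E t\<^sub>1) (?E ?r)"
      using R[OF a(2) t1 r'] r Node.IH(1)[OF t1] by simp
    then show ?thesis
      using False a by (simp add: Let_def)
  qed
qed

text \<open>In this formula \<open>f\<close> enters only through its value at \<open>F_gen\<close>,
  so morphisms that agree there coincide. Linearity reduces it to single trees.\<close>

lemma morphism_unique:
  assumes "f \<in> F_space \<gamma> \<rightarrow>\<^sub>E V" "linear_map_on F_scale scale (F_space \<gamma>) f"
    "commutes_on \<gamma> F_L L (F_space \<gamma>) f" "commutes_on \<gamma> F_R R (F_space \<gamma>) f"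
  shows "f = restrict (lin_ext scale (tree_eval L R (f F_gen))) (F_space \<gamma>)"
proof
  fix v
  show "f v = restrict (lin_ext scale (tree_eval L R (f F_gen))) (F_space \<gamma>) v"
  proof (cases "v \<in> F_space \<gamma>")
    case True
    then have "f v = lin_ext scale (tree_eval L R (f F_gen)) v"
    proof (induction rule: F_space_induct)
      case (single t c)
      have "f (F_scale c (Poly_Mapping.single t 1)) = c *s f (Poly_Mapping.single t 1)"
        using assms(2) single single_in_F_space unfolding linear_map_on_def by blast
      then show ?case
        using morphism_single[OF assms(3,4) single] by (simp add: F_scale_single lin_ext_single)
    next
      case (add u v)
      then show ?case
        using assms(2) by (simp add: linear_map_on_def lin_ext_add)
    qed
    with True show ?thesis by simp
  next
    case False
    \<comment> \<open>Outside the space both functions are \<open>undefined\<close>.\<close>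
    then show ?thesis using assms(1) by (auto simp: PiE_def extensional_def)
  qed
qed

end

theorem theorem4p1p6:
  fixes \<gamma> :: nat
  shows "multiplicial_algebra (F_scale :: 'k::field_char_0 \<Rightarrow> _) \<gamma> (F_space \<gamma>) F_L F_R
    \<and> (F_gen :: evtree \<Rightarrow>\<^sub>0 'k) \<in> F_space \<gamma>
    \<and> (\<forall>(scale :: 'k \<Rightarrow> 'b::ab_group_add \<Rightarrow> 'b) A L R. \<forall>e\<in>A.
         multiplicial_algebra scale \<gamma> A L R \<longrightarrow>
         (\<exists>!f. f \<in> F_space \<gamma> \<rightarrow>\<^sub>E A
            \<and> linear_map_on F_scale scale (F_space \<gamma>) f
            \<and> commutes_on \<gamma> F_L L (F_space \<gamma>) f
            \<and> commutes_on \<gamma> F_R R (F_space \<gamma>) f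
            \<and> f F_gen = e))"
proof (intro conjI allI ballI impI)
  show "multiplicial_algebra (F_scale :: 'k \<Rightarrow> _) \<gamma> (F_space \<gamma>) F_L F_R"
    by (rule multiplicial_algebra_F)
  show "(F_gen :: evtree \<Rightarrow>\<^sub>0 'k) \<in> F_space \<gamma>"
    by (simp add: F_gen_def single_in_F_space one_node_in_evtrees)
next
  fix scale :: "'k \<Rightarrow> 'b \<Rightarrow> 'b" and A L R e
  assume e: "e \<in> A" and "multiplicial_algebra scale \<gamma> A L R"
  then interpret multiplicial_algebra scale \<gamma> A L R by simp
  show "\<exists>!f. f \<in> F_space \<gamma> \<rightarrow>\<^sub>E A
            \<and> linear_map_on F_scale scale (F_space \<gamma>) f
            \<and> commutes_on \<gamma> F_L L (F_space \<gamma>) f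
            \<and> commutes_on \<gamma> F_R R (F_space \<gamma>) f
            \<and> f F_gen = e"
    \<comment> \<open>The facts of \<open>morphism_exists\<close> fix the witness;
      \<open>morphism_unique\<close> turns any competitor into the same formula once its value at
      \<open>F_gen\<close> is replaced by \<open>e\<close>.\<close>
    by (rule ex1I, intro conjI, (rule morphism_exists[OF e])+, elim conjE)
      (drule (3) morphism_unique, simp)
qed

end
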